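(* Let $n$ be a positive integer and let $r\le n$ be a positive integer. If $1\le i\le\binom{2r}{r}$ and $t$ is an integer with $M_r(i-1)<t\le M_r(i)$, then $$b(t)=M_r\!\left(\binom{2r}{r}-i\right).$$
   Context: $\binom{[n]}{r}$ is the set of all $r$-element subsets of $[n]=\{1,\dots,n\}$. For $F\subseteq\binom{[n]}{r}$, the blocker $B(F)$ is the set of those $e\in\binom{[n]}{r}$ that meet (have non-empty intersection with) every member of $F$. For an integer $0\le t\le\binom{n}{r}$, $b(t)$ is the maximum of $|B(F)|$ over all $F\subseteq\binom{[n]}{r}$ with $|F|=t$. For a sequence $\sigma=(\sigma_1,\dots,\sigma_m)$ of symbols $\wedge$ ("and") and $\vee$ ("or"), where $m<n$, $T_r(\sigma)$ is the set of $e\in\binom{[n]}{r}$ satisfying $1\in e\ \sigma_1\,(2\in e\ \sigma_2\,(3\in e\ \cdots\ \sigma_m\,(m+1\in e)\cdots))$ (for $\sigma$ empty: $1\in e$). Let $\Upsilon_r$ be the set of (possibly empty) sequences containing fewer than $r$ symbols $\wedge$ and fewer than $r$ symbols $\vee$, and $\Theta_r=\Upsilon_r\cup\{\alpha,\omega\}$ with two new elements $\alpha,\omega$; put $T_r(\alpha)=\emptyset$, $T_r(\omega)=\binom{[n]}{r}$. One has $|\Theta_r|=\binom{2r}{r}+1$. Order $\Theta_r$ linearly as follows: append a symbol $*$ at the end of every sequence in $\Upsilon_r$ and compare the results lexicographically with $\wedge<*<\vee$; $\alpha$ is the minimal element and $\omega$ the maximal element. Let $\sigma_0=\alpha<\sigma_1<\dots<\sigma_{\binom{2r}{r}}=\omega$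 be the elements of $\Theta_r$ in this order (here $\sigma_i$ denotes an element of $\Theta_r$), and $M_r(i)=|T_r(\sigma_i)|$.
   Formalization: The formal theorem additionally assumes n = r or n ≥ 2r; for every r < n < 2r the printed claim fails (e.g. n = 3, r = 2, i = 4, t = 3: b(3) = 3 but M_2(2) = 2). For n = r, atoms k ∈ e with k > n are read as false. *)

theory Defs
  imports Complex_Main "HOL-Library.Ramsey"
begin

text \<open>The collection of all \<open>r\<close>-element subsets of \<open>[n]\<close> is \<open>nsets {1..n} r\<close>, also written
  \<open>[{1..n}]\<^bsup>r\<^esup>\<close>.\<close>

definition blocker :: "nat \<Rightarrow> nat \<Rightarrow> nat set set \<Rightarrow> nat set set" where
  "blocker n r F = {e \<in> nsets {1..n} r. \<forall>f\<in>F. e \<inter> f \<noteq> {}}"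

text \<open>The maximum below is over a finite set, which is nonempty exactly if \<open>t \<le> n choose r\<close>;
  otherwise the value is unspecified.\<close>

definition max_blocker :: "nat \<Rightarrow> nat \<Rightarrow> nat \<Rightarrow> nat" where
  "max_blocker n r t = Max {card (blocker n r F) | F. F \<subseteq> nsets {1..n} r \<and> card F = t}"

datatype connective = And | Or

text \<open>\<open>sat k [s\<^sub>1, \<dots>, s\<^sub>m] e\<close> is the condition
  \<open>k \<in> e s\<^sub>1 (k+1 \<in> e s\<^sub>2 (\<dots> s\<^sub>m (k+m \<in> e)\<dots>))\<close>.
  For \<open>e \<subseteq> {1..n}\<close>, an atom \<open>j \<in> e\<close> with \<open>j > n\<close> is false.\<close>

fun sat :: "nat \<Rightarrow> connective list \<Rightarrow> nat set \<Rightarrow> bool" where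
  "sat k [] e \<longleftrightarrow> k \<in> e"
| "sat k (And # s) e \<longleftrightarrow> k \<in> e \<and> sat (Suc k) s e"
| "sat k (Or # s) e \<longleftrightarrow> k \<in> e \<or> sat (Suc k) s e"

datatype theta = Alpha | Seq "connective list" | Omega

fun T :: "nat \<Rightarrow> nat \<Rightarrow> theta \<Rightarrow> nat set set" where
  "T n r Alpha = {}"
| "T n r (Seq s) = {e \<in> nsets {1..n} r. sat 1 s e}"
| "T n r Omega = nsets {1..n} r"

definition Upsilon :: "nat \<Rightarrow> connective list set" where
  "Upsilon r = {s. count_list s And < r \<and> count_list s Or < r}"

definition Theta :: "nat \<Rightarrow> theta set" where
  "Theta r = Seq ` Upsilon r \<union> {Alpha, Omega}"

text \<open>The alphabet \<open>\<and> < * < \<or>\<close> is encoded by \<open>0 < 1 < 2\<close>; in particular the final \<open>1\<close> in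
  \<open>starred s\<close> is the appended symbol \<open>*\<close>.\<close>

fun letter_code :: "connective \<Rightarrow> nat" where
  "letter_code And = 0"
| "letter_code Or = 2"

definition starred :: "connective list \<Rightarrow> nat list" where
  "starred s = map letter_code s @ [1]"

lemma inj_starred: "starred s = starred s' \<longleftrightarrow> s = s'"
proof -
  have "inj letter_code"
    by (rule injI) (metis letter_code.elims zero_neq_numeral)
  then show ?thesis
    by (simp add: starred_def inj_map_eq_map)
qed

instantiation theta :: linorder
begin

fun less_theta :: "theta \<Rightarrow> theta \<Rightarrow> bool" where
  "less_theta x Alpha \<longleftrightarrow> False"
| "less_theta Alpha (Seq s) \<longleftrightarrow> True"
| "less_theta (Seq s) (Seq s') \<longleftrightarrow> (starred s, starred s') \<in> lexord {(a, b). a < b}"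
| "less_theta Omega (Seq s) \<longleftrightarrow> False"
| "less_theta x Omega \<longleftrightarrow> x \<noteq> Omega"

definition less_eq_theta :: "theta \<Rightarrow> theta \<Rightarrow> bool" where
  "less_eq_theta x y \<longleftrightarrow> x < y \<or> x = y"

instance
proof
  have tr: "trans (lexord {(a, b). a < (b::nat)})"
    by (rule lexord_transI) (auto simp: trans_def)
  have irr: "\<not> x < x" for x :: theta
    by (cases x) (simp_all add: lexord_irreflexive)
  have trans_less: "x < z" if "x < y" "y < z" for x y z :: theta
    using that by (cases x; cases y; cases z) (simp_all, blast intro: transD[OF tr])
  have total: "x < y \<or> x = y \<or> y < x" for x y :: theta
  proof -
    have "(u, v) \<in> lexord {(a, b). a < b} \<or> u = v \<or> (v, u) \<in> lexord {(a, b). a < b}"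
      for u v :: "nat list"
      by (rule lexord_linear) auto
    then show ?thesis
      by (cases x; cases y) (simp_all, metis inj_starred)
  qed
  fix x y z :: theta
  show "x < y \<longleftrightarrow> x \<le> y \<and> \<not> y \<le> x"
    using irr trans_less by (auto simp: less_eq_theta_def)
  show "x \<le> x"
    by (simp add: less_eq_theta_def)
  show "x \<le> y \<Longrightarrow> y \<le> z \<Longrightarrow> x \<le> z"
    using trans_less by (auto simp: less_eq_theta_def)
  show "x \<le> y \<Longrightarrow> y \<le> x \<Longrightarrow> x = y"
    using irr trans_less by (auto simp: less_eq_theta_def)
  show "x \<le> y \<or> y \<le> x"
    using total by (auto simp: less_eq_theta_def)
qed

end

definition \<sigma> :: "nat \<Rightarrow> nat \<Rightarrow> theta" where
  "\<sigma> r i = sorted_list_of_set (Theta r) ! i"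

definition M :: "nat \<Rightarrow> nat \<Rightarrow> nat \<Rightarrow> nat" where
  "M n r i = card (T n r (\<sigma> r i))"

text \<open>\<open>sorted_list_of_set\<close> is meaningful only for finite sets.\<close>

lemma finite_Theta: "finite (Theta r)"
proof -
  have len: "length s = count_list s And + count_list s Or" for s
  proof (induction s)
    case (Cons a s)
    then show ?case by (cases a) auto
  qed simp
  have "Upsilon r \<subseteq> {s. set s \<subseteq> {And, Or} \<and> length s \<le> 2 * r}"
  proof
    fix s assume "s \<in> Upsilon r"
    then have "length s \<le> 2 * r"
      using len[of s] by (simp add: Upsilon_def)
    moreover have "set s \<subseteq> {And, Or}"
      using connective.exhaust by blast
    ultimately show "s \<in> {s. set s \<subseteq> {And, Or} \<and> length s \<le> 2 * r}"
      by simp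
  qed
  then have "finite (Upsilon r)"
    using finite_lists_length_le[of "{And, Or}" "2 * r"] finite_subset by blast
  then show ?thesis
    by (simp add: Theta_def)
qed

text \<open>For \<open>r < n < 2 * r\<close> any two members of \<open>[{1..n}]\<^bsup>r\<^esup>\<close> meet, so that
  \<open>max_blocker n r t = n choose r\<close> for all \<open>t \<le> n choose r\<close>, and the formula relating
  \<open>max_blocker\<close> to \<open>M\<close> breaks down: at \<open>t = n choose r\<close> it would force
  \<open>card (T n r (Seq [])) = n choose r\<close>, although this set is \<open>{e \<in> [{1..n}]\<^bsup>r\<^esup>. 1 \<in> e}\<close>.
  The remainder of this theory verifies the instance \<open>n = 3\<close>, \<open>r = 2\<close>. This is why the formula
  is claimed under \<open>n = r \<or> 2 * r \<le> n\<close> and not for all \<open>n \<ge> r\<close>.\<close>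

lemma Upsilon_2: "Upsilon 2 = {[], [And], [Or], [And, Or], [Or, And]}"
proof -
  have "s \<in> {[], [And], [Or], [And, Or], [Or, And]}"
    if c: "count_list s And < 2" "count_list s Or < 2" for s
  proof (cases s)
    case (Cons a s1)
    note 1 = this
    show ?thesis
    proof (cases s1)
      case (Cons b s2)
      note 2 = this
      show ?thesis
      proof (cases s2)
        case Nil
        then show ?thesis using c 1 2 by (cases a; cases b) auto
      next
        case (Cons d s3)
        then show ?thesis using c 1 2 by (cases a; cases b; cases d) auto
      qed
    qed (use 1 in \<open>cases a; simp\<close>)
  qed simp
  then show ?thesis by (auto simp: Upsilon_def)
qed

lemma sorted_Theta_2: "sorted_list_of_set (Theta 2) =
  [Alpha, Seq [And], Seq [And, Or], Seq [], Seq [Or, And], Seq [Or], Omega]" (is "_ = ?l")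
proof -
  have "Theta 2 = set ?l" by (auto simp: Theta_def Upsilon_2)
  moreover have "sorted ?l" by (simp add: less_eq_theta_def starred_def)
  moreover have "distinct ?l" by simp
  ultimately show ?thesis by (metis sorted_list_of_set.idem_if_sorted_distinct)
qed

lemma nsets_3_2: "nsets {1..3::nat} 2 = {{1,2},{1,3},{2,3}}"
proof -
  have *: "{1..3::nat} = {1,2,3}" by auto
  show ?thesis
    unfolding * nsets_2_eq by (simp add: insert_Diff_if insert_commute)
qed

lemma doubletons_3_2_neq: "{1,2::nat} \<noteq> {1,3}" "{1,2::nat} \<noteq> {2,3}" "{1,3::nat} \<noteq> {2,3}" by auto

lemma M_3_2: "M 3 2 2 = 2" "M 3 2 3 = 2" "M 3 2 4 = 3"
proof -
  have "{e \<in> nsets {1..3::nat} 2. sat 1 [And,Or] e} = {{1,2},{1,3}}"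
       "{e \<in> nsets {1..3::nat} 2. sat 1 [] e} = {{1,2},{1,3}}"
       "{e \<in> nsets {1..3::nat} 2. sat 1 [Or,And] e} = {{1,2},{1,3},{2,3}}"
    unfolding nsets_3_2 by (auto simp: numeral_2_eq_2 numeral_3_eq_3)
  then show "M 3 2 2 = 2" "M 3 2 3 = 2" "M 3 2 4 = 3"
    using doubletons_3_2_neq by (simp_all add: M_def \<sigma>_def sorted_Theta_2)
qed

lemma max_blocker_3_2: "max_blocker 3 2 3 = 3"
proof -
  let ?N = "nsets {1..3::nat} 2"
  have c: "card ?N = 3" and f: "finite ?N" unfolding nsets_3_2 using doubletons_3_2_neq by simp_all
  have "F = ?N" if "F \<subseteq> ?N" "card F = 3" for F
    using card_subset_eq[OF f that(1)] that c by simp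
  then have "{card (blocker 3 2 F) |F. F \<subseteq> ?N \<and> card F = 3} = {card (blocker 3 2 ?N)}"
    using c by auto
  moreover have "blocker 3 2 ?N = ?N"
    unfolding blocker_def nsets_3_2 by auto
  ultimately show ?thesis by (simp only: max_blocker_def c Max_singleton)
qed

lemma blocker_formula_fails:
  "\<not> (\<forall>n r i t. 0 < n \<and> 0 < r \<and> r \<le> n \<and> 1 \<le> i \<and> i \<le> (2 * r) choose r \<and>
     M n r (i - 1) < t \<and> t \<le> M n r i \<longrightarrow> max_blocker n r t = M n r (((2 * r) choose r) - i))"
proof
  have [simp]: "(4 choose 2 :: nat) = 6" by (simp add: numeral_eq_Suc)
  assume a: "\<forall>n r i t. 0 < n \<and> 0 < r \<and> r \<le> n \<and> 1 \<le> i \<and> i \<le> (2 * r) choose r \<and>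
     M n r (i - 1) < t \<and> t \<le> M n r i \<longrightarrow> max_blocker n r t = M n r (((2 * r) choose r) - i)"
  show False using a[rule_format, of 3 2 4 3] by (simp add: M_3_2 max_blocker_3_2)
qed

end

theory Submission
  imports Defs
begin

text \<open>A monotone formula and its dual, obtained by exchanging \<open>\<and>\<close> and \<open>\<or>\<close>, are never true on two
  disjoint sets, so every \<open>F \<subseteq> T n r u\<close> is blocked by all of \<open>T n r (dual u)\<close>. Duality reverses
  the order of \<open>Theta r\<close>, which has \<open>((2 * r) choose r) + 1\<close> elements; hence the dual of \<open>\<sigma> r i\<close> is
  \<open>\<sigma> r (((2 * r) choose r) - i)\<close>, and the asserted value is attained.

  For \<open>n = r\<close> there is only one \<open>r\<close>-set. For \<open>2 * r \<le> n\<close> the upper bound is a form of the Kruskal--Katona theorem for cross-intersecting families, as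
  found by Hilton. A set \<open>x\<close> of positive integers is regarded as a threshold for the lexicographic
  order in which \<open>f\<close> comes before \<open>x\<close> if the smallest element of their symmetric difference lies
  in \<open>f\<close>. Theorem \<open>threshold_bound\<close> says: if \<open>A\<close> and \<open>B\<close> are cross-intersecting families of
  \<open>a\<close>-sets and \<open>b\<close>-sets in \<open>{1..n}\<close> with \<open>a + b \<le> n\<close>, then either \<open>A\<close> is not larger than the family
  of \<open>a\<close>-sets before \<open>x\<close>, or \<open>B\<close> is not larger than the family of \<open>b\<close>-sets before the complement
  of \<open>x\<close>. The proof is by induction on \<open>n\<close>, in the spirit of Frankl's short proof of
  Kruskal--Katona: shifting replaces \<open>n\<close> by smaller elements, and afterwards the sets without \<open>n\<close>
  and the links of \<open>n\<close> form four cross-intersecting pairs in \<open>{1..n - 1}\<close>. The point of allowing an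
  arbitrary threshold is that the same \<open>x\<close> serves all four pairs, so that no arithmetic with
  cascades of binomial coefficients is needed.

  It remains to bound the families produced by suitable thresholds in terms of the values
  \<open>M n r i\<close>. Between consecutive formulas \<open>u < v\<close> of \<open>Theta r\<close> let \<open>x\<close> be the lexicographically
  first \<open>r\<close>-set of positive integers on which \<open>u\<close> is false. If an \<open>r\<close>-set \<open>f\<close> comes before \<open>x\<close>
  and \<open>j\<close> is their smallest difference, then the formula that spells out \<open>x\<close> below \<open>j\<close> belongs to \<open>Theta r\<close>, and it distinguishes
  \<open>f\<close> from \<open>x\<close>; as no formula lies strictly between \<open>u\<close> and \<open>v\<close>, the sets before \<open>x\<close> satisfy \<open>u\<close>.
  In the same way the sets before the complement of \<open>x\<close> satisfy the dual of \<open>v\<close>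
  (lemma \<open>separating_threshold\<close>).\<close>

section \<open>Shifting\<close>

definition cross_intersecting :: "'a set set \<Rightarrow> 'a set set \<Rightarrow> bool" where
  "cross_intersecting A B \<longleftrightarrow> (\<forall>f\<in>A. \<forall>g\<in>B. f \<inter> g \<noteq> {})"

definition shift_set :: "'a \<Rightarrow> 'a \<Rightarrow> 'a set set \<Rightarrow> 'a set \<Rightarrow> 'a set" where
  "shift_set m x A f =
    (if m \<in> f \<and> x \<notin> f \<and> insert x (f - {m}) \<notin> A then insert x (f - {m}) else f)"

lemma inj_on_shift_set: "inj_on (shift_set m x A) A"
proof (rule inj_onI)
  fix f g assume fg: "f \<in> A" "g \<in> A" and eq: "shift_set m x A f = shift_set m x A g"
  have "f = g" if "m \<in> f" "x \<notin> f" "m \<in> g" "x \<notin> g" "insert x (f - {m}) = insert x (g - {m})"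
    using that by (metis Diff_insert_absorb insert_Diff insert_Diff_if insert_iff insert_commute)
  then show "f = g"
    using fg eq unfolding shift_set_def by (metis (no_types, lifting))
qed

text \<open>Only a shifted \<open>f\<close> against an unshifted \<open>g\<close> is critical: the shift can destroy their intersection
  only if \<open>f\<close> and \<open>g\<close> meet in \<open>m\<close> alone. Then \<open>g\<close> stayed because its own shift was already present,
  and that shift misses \<open>f\<close>.\<close>

lemma cross_intersecting_shift:
  assumes "cross_intersecting A B"
  shows "cross_intersecting (shift_set m x A ` A) (shift_set m x B ` B)"
proof -
  have half: "insert x (f - {m}) \<inter> g \<noteq> {}"
    if ci: "cross_intersecting C D" and f: "f \<in> C" "m \<in> f" "x \<notin> f"
      and g: "g \<in> D" and stay: "\<not> (m \<in> g \<and> x \<notin> g \<and> insert x (g - {m}) \<notin> D)"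
    for C D :: "'a set set" and f g
  proof
    assume empty: "insert x (f - {m}) \<inter> g = {}"
    have "f \<inter> g \<noteq> {}" using ci f g by (auto simp: cross_intersecting_def)
    then have "m \<in> g" "x \<notin> g" using empty f by auto
    have "insert x (g - {m}) \<in> D" using \<open>m \<in> g\<close> \<open>x \<notin> g\<close> stay by blast
    then have "f \<inter> insert x (g - {m}) \<noteq> {}"
      using ci f by (simp only: cross_intersecting_def) blast
    then show False using empty f by auto
  qed
  have ci': "cross_intersecting B A"
    using assms by (auto simp: cross_intersecting_def Int_commute)
  have "shift_set m x A f \<inter> shift_set m x B g \<noteq> {}" if fg: "f \<in> A" "g \<in> B" for f g
  proof (cases "m \<in> f \<and> x \<notin> f \<and> insert x (f - {m}) \<notin> A")
    case fm: True
    then show ?thesis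
      using half[OF assms fg(1) _ _ fg(2)] by (auto simp: shift_set_def)
  next
    case fs: False
    show ?thesis
    proof (cases "m \<in> g \<and> x \<notin> g \<and> insert x (g - {m}) \<notin> B")
      case True
      then have "insert x (g - {m}) \<inter> f \<noteq> {}"
        using half[OF ci' fg(2) _ _ fg(1) fs] by simp
      moreover have "shift_set m x A f = f" "shift_set m x B g = insert x (g - {m})"
        using fs True by (auto simp: shift_set_def)
      ultimately show ?thesis by (simp add: Int_commute)
    next
      case False
      then have "shift_set m x A f = f" "shift_set m x B g = g"
        using fs by (auto simp: shift_set_def)
      then show ?thesis using assms fg by (simp add: cross_intersecting_def)
    qed
  qed
  then show ?thesis by (auto simp: cross_intersecting_def)
qed

lemma shift_subset_nsets:
  assumes "A \<subseteq> nsets S a" "x \<in> S"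
  shows "shift_set m x A ` A \<subseteq> nsets S a"
proof -
  have "insert x (f - {m}) \<in> nsets S a" if "f \<in> nsets S a" "m \<in> f" "x \<notin> f" for f
    using that assms(2) card_gt_0_iff[of f]
    by (auto simp: nsets_def card_Diff_singleton)
  then show ?thesis
    using assms(1) by (auto simp: shift_set_def)
qed

lemma shift_members_subset:
  assumes "x \<noteq> m"
  shows "{h \<in> shift_set m x A ` A. m \<in> h} \<subseteq> {f \<in> A. m \<in> f}"
  using assms by (auto simp: shift_set_def split: if_splits)

lemma moved_notin_shift:
  assumes "x \<noteq> m" "m \<in> f" "x \<notin> f" "insert x (f - {m}) \<notin> A"
  shows "f \<notin> shift_set m x A ` A"
proof
  assume "f \<in> shift_set m x A ` A"
  then obtain g where "f = shift_set m x A g" by blast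
  then show False using assms by (auto simp: shift_set_def split: if_splits)
qed

text \<open>Among all cross-intersecting pairs of the given sizes, one with the fewest occurrences of \<open>m\<close> is
  stable, since a shift that changes anything removes an occurrence of \<open>m\<close>. Both families have to
  be shifted together to remain cross-intersecting, although stability is stated for the first only.\<close>

lemma exists_shifted_pair:
  fixes S :: "'a set"
  assumes fin: "finite S"
    and "A \<subseteq> nsets S a" "B \<subseteq> nsets S b" "cross_intersecting A B"
  obtains A' B' where "A' \<subseteq> nsets S a" "B' \<subseteq> nsets S b" "cross_intersecting A' B'"
    "card A' = card A" "card B' = card B"
    "\<And>f x. \<lbrakk>f \<in> A'; m \<in> f; x \<in> S - f\<rbrakk> \<Longrightarrow> insert x (f - {m}) \<in> A'"
proof -
  define P where "P = (\<lambda>(C, D). C \<subseteq> nsets S a \<and> D \<subseteq> nsets S b \<and> cross_intersecting C D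
    \<and> card C = card A \<and> card D = card B)"
  define w where "w = (\<lambda>(C, D). card {f \<in> C. m \<in> f} + card {g \<in> D. m \<in> (g::'a set)})"
  have "P (A, B)" using assms by (simp add: P_def)
  then obtain A' B' where P: "P (A', B')" and least: "\<And>C D. P (C, D) \<Longrightarrow> w (A', B') \<le> w (C, D)"
    using ex_has_least_nat[of P "(A, B)" w] by (metis surj_pair)
  have finA: "finite A'" and finB: "finite B'"
    using P fin finite_subset[OF _ finite_imp_finite_nsets] by (auto simp: P_def)
  have stable: "insert x (f - {m}) \<in> A'" if f: "f \<in> A'" "m \<in> f" "x \<in> S - f" for f x
  proof (rule ccontr)
    assume new: "insert x (f - {m}) \<notin> A'"
    let ?C = "shift_set m x A' ` A'" and ?D = "shift_set m x B' ` B'"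
    have xm: "x \<noteq> m" using f by auto
    have "P (?C, ?D)"
      using P f cross_intersecting_shift[of A' B' m x]
      by (simp add: P_def shift_subset_nsets card_image inj_on_shift_set)
    then have "w (A', B') \<le> w (?C, ?D)" by (rule least)
    moreover have "card {h \<in> ?D. m \<in> h} \<le> card {g \<in> B'. m \<in> g}"
      by (rule card_mono[OF _ shift_members_subset[OF xm]]) (simp add: finB)
    moreover have "card {h \<in> ?C. m \<in> h} < card {f \<in> A'. m \<in> f}"
    proof (rule psubset_card_mono)
      show "{h \<in> ?C. m \<in> h} \<subset> {f \<in> A'. m \<in> f}"
        using shift_members_subset[OF xm, of A'] moved_notin_shift[of x m f A'] f xm new by blast
    qed (simp add: finA)
    ultimately show False by (simp add: w_def)
  qed
  show ?thesis
    using that[of A' B'] P stable by (simp add: P_def)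
qed

section \<open>Cross-intersecting families and thresholds\<close>

text \<open>The position \<open>0\<close> is ignored, so that complements can be taken in the whole type; the threshold \<open>x\<close>
  need not be contained in the ground set of \<open>f\<close>.\<close>

definition precedes :: "nat set \<Rightarrow> nat set \<Rightarrow> bool" where
  "precedes f x \<longleftrightarrow> (\<exists>j. j \<in> f \<and> j \<notin> x \<and> (\<forall>i\<in>{1..<j}. i \<in> f \<longleftrightarrow> i \<in> x))"

definition below :: "nat \<Rightarrow> nat \<Rightarrow> nat set \<Rightarrow> nat set set" where
  "below n a x = {f \<in> nsets {1..n} a. precedes f x}"

lemma finite_nsets_interval: "finite (nsets {1..n::nat} a)"
  by (rule finite_imp_finite_nsets) simp

lemma finite_below: "finite (below n a x)"
  by (rule finite_subset[OF _ finite_nsets_interval[of n a]]) (auto simp: below_def)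

lemma precedes_total:
  assumes "f \<subseteq> {1..n}"
  shows "precedes f x \<or> precedes ({1..n} - f) (- x) \<or> f = x \<inter> {1..n}"
proof (rule disjCI)
  assume "\<not> (precedes ({1..n} - f) (- x) \<or> f = x \<inter> {1..n})"
  then have ne: "f \<noteq> x \<inter> {1..n}" and n2: "\<not> precedes ({1..n} - f) (- x)" by auto
  define j where "j = (LEAST j. j \<in> {1..n} \<and> \<not> (j \<in> f \<longleftrightarrow> j \<in> x))"
  have "\<exists>j. j \<in> {1..n} \<and> \<not> (j \<in> f \<longleftrightarrow> j \<in> x)" using ne assms by blast
  from LeastI_ex[OF this, folded j_def]
  have j: "j \<in> {1..n}" "\<not> (j \<in> f \<longleftrightarrow> j \<in> x)" by auto
  have agree: "i \<in> f \<longleftrightarrow> i \<in> x" if "i \<in> {1..<j}" for i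
    using not_less_Least[of i "\<lambda>j. j \<in> {1..n} \<and> \<not> (j \<in> f \<longleftrightarrow> j \<in> x)"] that j(1)
    unfolding j_def[symmetric] by auto
  have "j \<in> f"
  proof (rule ccontr)
    assume "j \<notin> f"
    then have "precedes ({1..n} - f) (- x)"
      unfolding precedes_def using j agree by (intro exI[of _ j]) auto
    then show False using n2 by simp
  qed
  then show "precedes f x" unfolding precedes_def using j agree by auto
qed

lemma precedes_insert_last:
  assumes "f \<subseteq> {1..n}" "precedes f x"
  shows "precedes (insert (Suc n) f) x"
proof -
  obtain j where j: "j \<in> f" "j \<notin> x" "\<forall>i\<in>{1..<j}. i \<in> f \<longleftrightarrow> i \<in> x"
    using assms(2) by (auto simp: precedes_def)
  have "j \<le> n" using j(1) assms(1) by auto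
  then have "j \<in> insert (Suc n) f \<and> j \<notin> x \<and>
      (\<forall>i\<in>{1..<j}. i \<in> insert (Suc n) f \<longleftrightarrow> i \<in> x)"
    using j by auto
  then show ?thesis unfolding precedes_def by blast
qed

text \<open>The sets without \<open>n + 1\<close> and the links of \<open>n + 1\<close> that come before \<open>x\<close> inside \<open>{1..n}\<close> all give
  sets before \<open>x\<close>. The inequality can be strict: a link that agrees with \<open>x\<close> on \<open>{1..n}\<close> may come
  before \<open>x\<close> only after \<open>n + 1\<close> is added.\<close>

lemma below_Suc:
  "card (below n (Suc a) x) + card (below n a x) \<le> card (below (Suc n) (Suc a) x)"
proof -
  let ?I = "insert (Suc n) ` below n a x"
  have sub: "f \<subseteq> {1..n}" if "f \<in> below n c x" for f c
    using that by (auto simp: below_def nsets_def)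
  have "inj_on (insert (Suc n)) (below n a x)"
  proof (rule inj_onI)
    fix f g assume "f \<in> below n a x" "g \<in> below n a x" "insert (Suc n) f = insert (Suc n) g"
    moreover have "Suc n \<notin> f" "Suc n \<notin> g"
      using sub[OF \<open>f \<in> _\<close>] sub[OF \<open>g \<in> _\<close>] by auto
    ultimately show "f = g" by (simp add: insert_ident)
  qed
  then have "card ?I = card (below n a x)" by (rule card_image)
  moreover have "below n (Suc a) x \<inter> ?I = {}"
  proof -
    have "Suc n \<notin> f" if "f \<in> below n (Suc a) x" for f using sub[OF that] by auto
    then show ?thesis by blast
  qed
  ultimately have "card (below n (Suc a) x) + card (below n a x) = card (below n (Suc a) x \<union> ?I)"
    by (simp add: card_Un_disjoint finite_below)
  also have "\<dots> \<le> card (below (Suc n) (Suc a) x)"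
  proof (rule card_mono[OF finite_below], rule Un_least)
    show "below n (Suc a) x \<subseteq> below (Suc n) (Suc a) x"
      by (fastforce simp: below_def nsets_def)
    show "?I \<subseteq> below (Suc n) (Suc a) x"
    proof
      fix h assume "h \<in> ?I"
      then obtain f where f: "f \<in> below n a x" "h = insert (Suc n) f" by blast
      have "Suc n \<notin> f" using sub[OF f(1)] by auto
      then show "h \<in> below (Suc n) (Suc a) x"
        using f precedes_insert_last[OF sub[OF f(1)]] by (auto simp: below_def nsets_def)
    qed
  qed
  finally show ?thesis .
qed

definition avoiding :: "nat \<Rightarrow> nat set set \<Rightarrow> nat set set" where
  "avoiding m A = {f \<in> A. m \<notin> f}"

definition link :: "nat \<Rightarrow> nat set set \<Rightarrow> nat set set" where
  "link m A = {f. m \<notin> f \<and> insert m f \<in> A}"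

lemma avoiding_link_nsets:
  assumes "A \<subseteq> nsets {1..Suc n} (Suc a)"
  shows "avoiding (Suc n) A \<subseteq> nsets {1..n} (Suc a)" "link (Suc n) A \<subseteq> nsets {1..n} a"
    "card A = card (avoiding (Suc n) A) + card (link (Suc n) A)"
proof -
  have sub: "f \<subseteq> {1..n}" if "f \<subseteq> {1..Suc n}" "Suc n \<notin> f" for f :: "nat set"
    using that by (auto simp: subset_eq le_Suc_eq)
  show "avoiding (Suc n) A \<subseteq> nsets {1..n} (Suc a)"
    using assms sub by (auto simp: avoiding_def nsets_def)
  show "link (Suc n) A \<subseteq> nsets {1..n} a"
  proof
    fix f assume "f \<in> link (Suc n) A"
    then have "Suc n \<notin> f" and "insert (Suc n) f \<in> nsets {1..Suc n} (Suc a)"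
      using assms by (auto simp: link_def)
    then show "f \<in> nsets {1..n} a"
      using sub[of f] by (auto simp: nsets_def)
  qed
  have fin: "finite A" using assms finite_nsets_interval finite_subset by blast
  have "inj_on (insert (Suc n)) (link (Suc n) A)"
  proof (rule inj_onI)
    fix f g assume "f \<in> link (Suc n) A" "g \<in> link (Suc n) A" "insert (Suc n) f = insert (Suc n) g"
    then show "f = g" unfolding link_def by (metis (no_types, lifting) insert_ident mem_Collect_eq)
  qed
  then have "card (insert (Suc n) ` link (Suc n) A) = card (link (Suc n) A)" by (rule card_image)
  moreover have "insert (Suc n) ` link (Suc n) A = {f \<in> A. Suc n \<in> f}"
  proof
    show "{f \<in> A. Suc n \<in> f} \<subseteq> insert (Suc n) ` link (Suc n) A"
    proof
      fix f assume f: "f \<in> {f \<in> A. Suc n \<in> f}"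
      then have "f = insert (Suc n) (f - {Suc n})" by blast
      moreover have "f - {Suc n} \<in> link (Suc n) A" using f by (simp add: link_def insert_absorb)
      ultimately show "f \<in> insert (Suc n) ` link (Suc n) A" by blast
    qed
  qed (auto simp: link_def)
  moreover have "card A = card {f \<in> A. Suc n \<notin> f} + card {f \<in> A. Suc n \<in> f}"
    using fin by (subst card_Un_disjoint[symmetric]) (auto intro: arg_cong[where f = card])
  ultimately show "card A = card (avoiding (Suc n) A) + card (link (Suc n) A)"
    by (simp add: avoiding_def)
qed

text \<open>Here \<open>a\<close>-sets and \<open>b\<close>-sets are complementary, and cross-intersecting means that \<open>A\<close> is disjoint
  from the family of complements of \<open>B\<close>. Thus \<open>card A + card B\<close> is at most the number of \<open>a\<close>-sets,
  and each \<open>a\<close>-set comes before \<open>x\<close>, or has its complement before \<open>- x\<close>, or is the one exception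
  \<open>x \<inter> {1..a + b}\<close>. If both bounds failed, the sum would be too large by one.\<close>

lemma threshold_bound_complementary:
  assumes A: "A \<subseteq> nsets {1..a + b} a" and B: "B \<subseteq> nsets {1..a + b} b"
    and ci: "cross_intersecting A B"
  shows "card A \<le> card (below (a + b) a x) \<or> card B \<le> card (below (a + b) b (- x))"
proof -
  let ?S = "{1..a + b}"
  let ?c = "\<lambda>g. ?S - g"
  have inj: "inj_on ?c C" if "C \<subseteq> nsets ?S b" for C
    by (rule inj_onI) (use that in \<open>auto simp: nsets_def\<close>)
  have compl: "?c g \<in> nsets ?S a" if "g \<in> nsets ?S b" for g
    using that by (auto simp: nsets_def card_Diff_subset)
  have compl': "?c f \<in> nsets ?S b" if "f \<in> nsets ?S a" for f
    using that by (auto simp: nsets_def card_Diff_subset)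
  have finA: "finite A" and finB: "finite B"
    using A B finite_nsets_interval finite_subset by blast+
  have belB: "below (a + b) b (- x) \<subseteq> nsets ?S b" by (auto simp: below_def)
  have disj: "A \<inter> ?c ` B = {}"
    using ci by (auto simp: cross_intersecting_def)
  have "card A + card B = card (A \<union> ?c ` B)"
    using disj finA finB card_image[OF inj[OF B]] by (simp only: card_Un_disjoint finite_imageI)
  also have "\<dots> \<le> card (nsets ?S a)"
    by (rule card_mono[OF finite_nsets_interval]) (use A B compl in auto)
  also have "\<dots> \<le> card (insert (x \<inter> ?S) (below (a + b) a x \<union> ?c ` below (a + b) b (- x)))"
  proof (rule card_mono)
    show "nsets ?S a \<subseteq> insert (x \<inter> ?S) (below (a + b) a x \<union> ?c ` below (a + b) b (- x))"
    proof
      fix f assume f: "f \<in> nsets ?S a"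
      then have fS: "f \<subseteq> ?S" by (auto simp: nsets_def)
      have "f = ?c (?c f)" using fS by blast
      then have "f \<in> ?c ` below (a + b) b (- x)" if "precedes (?c f) (- x)"
        using that compl'[OF f] by (auto simp: below_def intro!: image_eqI[of _ _ "?c f"])
      then show "f \<in> insert (x \<inter> ?S) (below (a + b) a x \<union> ?c ` below (a + b) b (- x))"
        using precedes_total[OF fS, of x] f by (auto simp: below_def)
    qed
  qed (simp add: finite_below)
  also have "\<dots> \<le> Suc (card (below (a + b) a x \<union> ?c ` below (a + b) b (- x)))"
    by (simp add: card_insert_if finite_below)
  also have "\<dots> \<le> Suc (card (below (a + b) a x) + card (?c ` below (a + b) b (- x)))"
    by (simp add: card_Un_le)
  also have "card (?c ` below (a + b) b (- x)) = card (below (a + b) b (- x))"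
    by (rule card_image[OF inj[OF belB]])
  finally show ?thesis by linarith
qed

text \<open>If \<open>B\<close> violates its bound, then by \<open>below_Suc\<close> one of its two parts violates the bound in
  \<open>{1..n}\<close>; by induction both parts of \<open>A\<close> then satisfy theirs, and adding them up gives the bound
  for \<open>A\<close>. This needs all four pairs of parts to be cross-intersecting. Three of them inherit this
  directly; for the two links it comes from shifting and \<open>a + b \<le> n\<close>.\<close>

theorem threshold_bound:
  assumes "a + b \<le> n" "A \<subseteq> nsets {1..n} a" "B \<subseteq> nsets {1..n} b" "cross_intersecting A B"
  shows "card A \<le> card (below n a x) \<or> card B \<le> card (below n b (- x))"
  using assms
proof (induction n arbitrary: a b A B)
  case 0
  then show ?case using threshold_bound_complementary[of A 0 0 B x] by simp
next
  case (Suc n)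
  show ?case
  proof (cases "a + b = Suc n")
    case True
    then show ?thesis using threshold_bound_complementary[of A a b B x] Suc.prems by simp
  next
    case False
    then have n: "a + b \<le> n" using Suc.prems(1) by simp
    show ?thesis
    proof (cases "A = {} \<or> B = {}")
      case True
      then show ?thesis by auto
    next
      case nonempty: False
      obtain f0 g0 where "f0 \<in> A" "g0 \<in> B" using nonempty by auto
      then have "f0 \<inter> g0 \<noteq> {}" "card f0 = a" "card g0 = b" "finite f0" "finite g0"
        using Suc.prems by (auto simp: cross_intersecting_def nsets_def)
      then have "a \<noteq> 0" "b \<noteq> 0" by auto
      then obtain a' b' where ab: "a = Suc a'" "b = Suc b'" by (metis not0_implies_Suc)
      obtain A' B' where A': "A' \<subseteq> nsets {1..Suc n} (Suc a')" and B': "B' \<subseteq> nsets {1..Suc n} (Suc b')"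
        and ci: "cross_intersecting A' B'" and cards: "card A' = card A" "card B' = card B"
        and stable: "\<And>f x. \<lbrakk>f \<in> A'; Suc n \<in> f; x \<in> {1..Suc n} - f\<rbrakk>
          \<Longrightarrow> insert x (f - {Suc n}) \<in> A'"
        using exists_shifted_pair[of "{1..Suc n}" A a B b "Suc n"] Suc.prems(2-4) ab
        by (metis finite_atLeastAtMost)
      note sA = avoiding_link_nsets[OF A'] and sB = avoiding_link_nsets[OF B']
      let ?A0 = "avoiding (Suc n) A'" and ?A1 = "link (Suc n) A'"
      let ?B0 = "avoiding (Suc n) B'" and ?B1 = "link (Suc n) B'"
      have c00: "cross_intersecting ?A0 ?B0"
        using ci by (auto simp: cross_intersecting_def avoiding_def)
      have c01: "cross_intersecting ?A0 ?B1"
        using ci by (fastforce simp: cross_intersecting_def avoiding_def link_def)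
      have c10: "cross_intersecting ?A1 ?B0"
        using ci by (fastforce simp: cross_intersecting_def avoiding_def link_def)
      have c11: "cross_intersecting ?A1 ?B1"
        unfolding cross_intersecting_def
      proof (intro ballI)
        fix f g assume f: "f \<in> ?A1" and g: "g \<in> ?B1"
        have fN: "f \<in> nsets {1..n} a'" and gN: "g \<in> nsets {1..n} b'" using f g sA sB by auto
        then have "card (f \<union> g) \<le> a' + b'"
          using card_Un_le[of f g] by (simp add: nsets_def)
        then have "card (f \<union> g) < card {1..n}" using n ab by simp
        then have "\<not> {1..n} \<subseteq> f \<union> g"
          using fN gN card_mono[of "f \<union> g" "{1..n}"] by (auto simp: nsets_def)
        \<comment> \<open>There is room to move the new element of \<open>f\<close> to a place outside \<open>f \<union> g\<close>.\<close>
        then obtain x where x: "x \<in> {1..n}" "x \<notin> f" "x \<notin> g" by blast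
        have "insert x (insert (Suc n) f - {Suc n}) \<in> A'"
          using f x by (intro stable) (auto simp: link_def)
        then have "insert x f \<in> A'" using f by (simp add: link_def)
        moreover have "insert (Suc n) g \<in> B'" using g by (simp add: link_def)
        ultimately have "insert x f \<inter> insert (Suc n) g \<noteq> {}"
          using ci unfolding cross_intersecting_def by blast
        moreover have "Suc n \<notin> insert x f" using x f by (auto simp: link_def)
        ultimately show "f \<inter> g \<noteq> {}" using x(3) by auto
      qed
      have i00: "card ?A0 \<le> card (below n a x) \<or> card ?B0 \<le> card (below n b (- x))"
        using Suc.IH[OF _ _ _ c00, of a b] n sA sB ab by simp
      have i01: "card ?A0 \<le> card (below n a x) \<or> card ?B1 \<le> card (below n b' (- x))"
        using Suc.IH[OF _ _ _ c01, of a b'] n sA sB ab by simp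
      have i10: "card ?A1 \<le> card (below n a' x) \<or> card ?B0 \<le> card (below n b (- x))"
        using Suc.IH[OF _ _ _ c10, of a' b] n sA sB ab by simp
      have i11: "card ?A1 \<le> card (below n a' x) \<or> card ?B1 \<le> card (below n b' (- x))"
        using Suc.IH[OF _ _ _ c11, of a' b'] n sA sB ab by simp
      show ?thesis
      proof (rule disjCI)
        assume "\<not> card B \<le> card (below (Suc n) b (- x))"
        then have "\<not> card ?B0 \<le> card (below n b (- x)) \<or> \<not> card ?B1 \<le> card (below n b' (- x))"
          using sB(3) cards(2) below_Suc[of n b' "- x"] unfolding ab by linarith
        then have "card ?A0 \<le> card (below n a x)" "card ?A1 \<le> card (below n a' x)"
          using i00 i01 i10 i11 by blast+
        then show "card A \<le> card (below (Suc n) a x)"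
          using sA(3) cards(1) below_Suc[of n a' x] unfolding ab by linarith
      qed
    qed
  qed
qed

section \<open>Formulas\<close>

fun holds :: "theta \<Rightarrow> nat set \<Rightarrow> bool" where
  "holds Alpha e \<longleftrightarrow> False"
| "holds (Seq s) e \<longleftrightarrow> sat 1 s e"
| "holds Omega e \<longleftrightarrow> True"

lemma T_holds: "T n r u = {e \<in> nsets {1..n} r. holds u e}"
  by (cases u) auto

lemma starred_less_simps:
  "(starred [], starred []) \<notin> lexord {(a, b). a < b}"
  "(starred [], starred (And # v)) \<notin> lexord {(a, b). a < b}"
  "(starred [], starred (Or # v)) \<in> lexord {(a, b). a < b}"
  "(starred (And # u), starred []) \<in> lexord {(a, b). a < b}"
  "(starred (Or # u), starred []) \<notin> lexord {(a, b). a < b}"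
  "(starred (And # u), starred (Or # v)) \<in> lexord {(a, b). a < b}"
  "(starred (Or # u), starred (And # v)) \<notin> lexord {(a, b). a < b}"
  "(starred (c # u), starred (c # v)) \<in> lexord {(a, b). a < b}
    \<longleftrightarrow> (starred u, starred v) \<in> lexord {(a, b). a < b}"
  by (cases c; simp add: starred_def)+

text \<open>Reading \<open>e\<close> from position \<open>k\<close> on as a word over \<open>\<and>\<close> (present) and \<open>\<or>\<close> (absent), \<open>s\<close> is true on \<open>e\<close>
  if and only if this word is lexicographically smaller than \<open>s\<close> followed by \<open>*\<close>; this makes truth
  monotone in the formula.\<close>

lemma sat_mono:
  assumes "(starred u, starred v) \<in> lexord {(a, b). a < b}" "sat k u e"
  shows "sat k v e"
  using assms
proof (induction u arbitrary: k v)
  case Nil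
  show ?case
  proof (cases v)
    case (Cons c v')
    then show ?thesis using Nil by (cases c) (auto simp: starred_less_simps)
  qed (use Nil in simp)
next
  case (Cons c u)
  show ?case
  proof (cases v)
    case Nil
    then show ?thesis using Cons.prems by (cases c) (auto simp: starred_less_simps)
  next
    case v: (Cons d v')
    then show ?thesis using Cons by (cases c; cases d) (auto simp: starred_less_simps)
  qed
qed

lemma holds_mono:
  assumes "u \<le> v" "holds u e"
  shows "holds v e"
  using assms by (cases u; cases v) (auto simp: less_eq_theta_def intro: sat_mono)

section \<open>Duality\<close>

fun dual_connective :: "connective \<Rightarrow> connective" where
  "dual_connective And = Or"
| "dual_connective Or = And"

fun dual :: "theta \<Rightarrow> theta" where
  "dual Alpha = Omega"
| "dual (Seq s) = Seq (map dual_connective s)"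
| "dual Omega = Alpha"

lemma sat_dual: "sat k (map dual_connective s) e \<longleftrightarrow> \<not> sat k s (- e)"
  by (induction k s e rule: sat.induct) auto

lemma holds_dual: "holds (dual u) e \<longleftrightarrow> \<not> holds u (- e)"
  by (cases u) (auto simp: sat_dual)

lemma sat_superset: "sat k s e \<Longrightarrow> e \<subseteq> e' \<Longrightarrow> sat k s e'"
  by (induction k s e rule: sat.induct) auto

lemma holds_dual_meets:
  assumes "holds u f" "holds (dual u) e"
  shows "e \<inter> f \<noteq> {}"
proof
  assume "e \<inter> f = {}"
  then have "f \<subseteq> - e" by blast
  then have "holds u (- e)" using assms(1) by (cases u) (auto intro: sat_superset)
  then show False using assms(2) by (simp add: holds_dual)
qed

lemma dual_connective_involution: "dual_connective (dual_connective c) = c"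
  by (cases c) auto

lemma dual_involution [simp]: "dual (dual u) = u"
  by (cases u) (auto simp: o_def dual_connective_involution)

lemma starred_less_dual:
  "(starred (map dual_connective v), starred (map dual_connective u)) \<in> lexord {(a, b). a < b}
    \<longleftrightarrow> (starred u, starred v) \<in> lexord {(a, b). a < b}"
proof (induction u arbitrary: v)
  case Nil
  show ?case
  proof (cases v)
    case (Cons d v')
    then show ?thesis by (cases d) (simp_all add: starred_less_simps)
  qed simp
next
  case (Cons c u)
  show ?case
  proof (cases v)
    case Nil
    then show ?thesis by (cases c) (simp_all add: starred_less_simps)
  next
    case v: (Cons d v')
    then show ?thesis using Cons by (cases c; cases d) (simp_all add: starred_less_simps)
  qed
qed

lemma dual_less_iff: "dual v < dual u \<longleftrightarrow> u < v"
  by (cases u; cases v) (simp_all add: starred_less_dual)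

lemma dual_le_iff: "dual v \<le> dual u \<longleftrightarrow> u \<le> v"
  using dual_less_iff by (metis dual_involution le_less)

lemma count_list_dual:
  "count_list (map dual_connective s) And = count_list s Or"
  "count_list (map dual_connective s) Or = count_list s And"
proof (induction s)
  case (Cons c s)
  { case 1 show ?case using Cons by (cases c) auto }
  { case 2 show ?case using Cons by (cases c) auto }
qed auto

lemma dual_Theta: "dual ` Theta r = Theta r"
proof -
  have sub: "dual ` Theta r \<subseteq> Theta r"
    by (auto simp: Theta_def Upsilon_def count_list_dual)
  moreover have "Theta r \<subseteq> dual ` Theta r"
    using sub by (metis dual_involution image_eqI image_subset_iff subsetI)
  ultimately show ?thesis by blast
qed

section \<open>Enumeration\<close>

text \<open>The two bounds are kept separate for the sake of the Pascal recursion that counts these words.\<close>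

lemma finite_bounded_words: "finite {s. count_list s And < a \<and> count_list s Or < b}"
proof (rule finite_subset)
  show "{s. count_list s And < a \<and> count_list s Or < b} \<subseteq> Upsilon (max a b)"
    by (auto simp: Upsilon_def)
  have "Upsilon (max a b) = Seq -` Theta (max a b)" by (auto simp: Theta_def)
  then show "finite (Upsilon (max a b))"
    by (simp add: finite_vimageI[OF finite_Theta] inj_def)
qed

text \<open>A nonempty word is determined by its first symbol and the rest, so the number of words plus one
  satisfies Pascal's rule, with the empty word supplying the second \<open>1\<close> on the right.\<close>

lemma card_bounded_words:
  "card {s. count_list s And < a \<and> count_list s Or < b} + 1 = (a + b) choose a"
proof (induction "a + b" arbitrary: a b)
  case 0
  then show ?case by simp
next
  case (Suc m)
  let ?W = "\<lambda>a b. {s. count_list s And < a \<and> count_list s Or < b}"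
  show ?case
  proof (cases "a = 0 \<or> b = 0")
    case True
    then show ?thesis by auto
  next
    case False
    then obtain a' b' where ab: "a = Suc a'" "b = Suc b'" by (metis not0_implies_Suc)
    have W: "?W a b = insert [] ((#) And ` ?W a' b \<union> (#) Or ` ?W a b')"
    proof (rule set_eqI)
      fix s
      show "s \<in> ?W a b \<longleftrightarrow> s \<in> insert [] ((#) And ` ?W a' b \<union> (#) Or ` ?W a b')"
      proof (cases s)
        case (Cons c s')
        then show ?thesis by (cases c) (auto simp: ab)
      qed (simp add: ab)
    qed
    have "card (?W a b) = Suc (card ((#) And ` ?W a' b \<union> (#) Or ` ?W a b'))"
      unfolding W by (subst card_insert_disjoint) (auto simp: finite_bounded_words)
    also have "\<dots> = Suc (card (?W a' b) + card (?W a b'))"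
      by (subst card_Un_disjoint) (auto simp: finite_bounded_words card_image)
    finally have "card (?W a b) + 1 = (card (?W a' b) + 1) + (card (?W a b') + 1)" by simp
    also have "\<dots> = ((a' + b) choose a') + ((a + b') choose a)"
      using Suc.hyps(1)[of a' b] Suc.hyps(1)[of a b'] Suc.hyps(2) ab by simp
    also have "\<dots> = (a + b) choose a"
      by (simp add: ab)
    finally show ?thesis .
  qed
qed

lemma card_Theta: "card (Theta r) = ((2 * r) choose r) + 1"
proof -
  have "finite (Seq ` Upsilon r)" by (rule finite_subset[OF _ finite_Theta[of r]]) (auto simp: Theta_def)
  then have "card (Theta r) = card (Seq ` Upsilon r) + 2"
    unfolding Theta_def by (subst card_Un_disjoint) auto
  also have "card (Seq ` Upsilon r) = card (Upsilon r)"
    by (rule card_image) (simp add: inj_on_def)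
  finally show ?thesis
    using card_bounded_words[of r r] by (simp add: Upsilon_def mult_2)
qed

lemma sigma_mem: "i \<le> (2 * r) choose r \<Longrightarrow> \<sigma> r i \<in> Theta r"
  unfolding \<sigma>_def
  by (metis Suc_eq_plus1 card_Theta finite_Theta le_imp_less_Suc nth_mem
      sorted_list_of_set.length_sorted_key_list_of_set set_sorted_list_of_set)

lemma sigma_less:
  assumes "i < j" "j \<le> (2 * r) choose r"
  shows "\<sigma> r i < \<sigma> r j"
  unfolding \<sigma>_def
  by (rule sorted_wrt_nth_less[OF sorted_list_of_set.strict_sorted_key_list_of_set])
    (use assms in \<open>simp_all add: card_Theta\<close>)

lemma sigma_surj:
  assumes "u \<in> Theta r"
  obtains j where "j \<le> (2 * r) choose r" "u = \<sigma> r j"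
proof -
  have "u \<in> set (sorted_list_of_set (Theta r))" using assms finite_Theta by simp
  then show ?thesis
    using that by (metis Suc_eq_plus1 card_Theta in_set_conv_nth less_Suc_eq_le \<sigma>_def
      sorted_list_of_set.length_sorted_key_list_of_set)
qed

lemma sigma_predecessor:
  assumes "u \<in> Theta r" "1 \<le> i" "i \<le> (2 * r) choose r" "u < \<sigma> r i"
  shows "u \<le> \<sigma> r (i - 1)"
proof -
  obtain j where j: "j \<le> (2 * r) choose r" "u = \<sigma> r j" by (rule sigma_surj[OF assms(1)])
  have "j < i"
    using sigma_less[of i j r] j assms(4) by (metis less_asym linorder_neqE_nat)
  then show ?thesis
    using sigma_less[of j "i - 1" r] j assms(3) by (cases "j = i - 1") (auto intro: less_imp_le)
qed

text \<open>The dual map permutes \<open>Theta r\<close> and reverses its order, so it turns the increasing enumeration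
  into the decreasing one.\<close>

lemma sigma_dual:
  assumes "i \<le> (2 * r) choose r"
  shows "\<sigma> r (((2 * r) choose r) - i) = dual (\<sigma> r i)"
proof -
  let ?L = "sorted_list_of_set (Theta r)"
  have len: "length ?L = ((2 * r) choose r) + 1" by (simp add: card_Theta)
  have "sorted_wrt (<) (rev (map dual ?L))"
    using sorted_list_of_set.strict_sorted_key_list_of_set[of "Theta r"]
    by (simp add: sorted_wrt_rev sorted_wrt_map dual_less_iff)
  moreover have "set (rev (map dual ?L)) = Theta r"
    by (simp add: finite_Theta dual_Theta)
  ultimately have "rev (map dual ?L) = ?L"
    by (metis sorted_list_of_set.idem_if_sorted_distinct strict_sorted_iff)
  then have "?L ! (((2 * r) choose r) - i) = rev (map dual ?L) ! (((2 * r) choose r) - i)" by simp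
  also have "\<dots> = dual (?L ! i)"
    using assms len by (simp add: rev_nth)
  finally show ?thesis by (simp add: \<sigma>_def)
qed

section \<open>The threshold between consecutive formulas\<close>

text \<open>The lexicographically first \<open>m\<close>-subset of \<open>{k..}\<close> on which \<open>s\<close> is false: it copies \<open>s\<close>, omits the
  position of the last atom, and then takes the next positions until it has \<open>m\<close> elements. This
  reading presupposes that \<open>s\<close> has fewer than \<open>m\<close> symbols \<open>\<and>\<close>.\<close>

fun first_failure :: "nat \<Rightarrow> nat \<Rightarrow> connective list \<Rightarrow> nat set" where
  "first_failure k m [] = {Suc k..k + m}"
| "first_failure k m (And # s) = insert k (first_failure (Suc k) (m - 1) s)"
| "first_failure k m (Or # s) = first_failure (Suc k) m s"

lemma first_failure_ge: "first_failure k m s \<subseteq> {k..}"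
  by (induction k m s rule: first_failure.induct) force+

lemma first_failure_finite_card:
  assumes "count_list s And < m"
  shows "finite (first_failure k m s)" "card (first_failure k m s) = m"
proof -
  have "finite (first_failure k m s) \<and> card (first_failure k m s) = m"
    using assms
  proof (induction k m s rule: first_failure.induct)
    case (2 k m s)
    have "k \<notin> first_failure (Suc k) (m - 1) s" using first_failure_ge[of "Suc k" "m - 1" s] by auto
    then show ?case using 2 by simp
  qed auto
  then show "finite (first_failure k m s)" "card (first_failure k m s) = m" by auto
qed

lemma not_sat_first_failure: "\<not> sat k s (first_failure k m s)"
proof (induction k m s rule: first_failure.induct)
  case (2 k m s)
  have "sat (Suc k) s (insert k e) \<longleftrightarrow> sat (Suc k) s e" for e
  proof -
    have "sat l s (insert k e) \<longleftrightarrow> sat l s e" if "k < l" for l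
      using that by (induction l s e rule: sat.induct) auto
    then show ?thesis by simp
  qed
  then show ?case using 2 by simp
next
  case (3 k m s)
  then show ?case using first_failure_ge[of "Suc k" m s] by auto
qed simp

lemma sat_initial_segment:
  "count_list s And < m \<Longrightarrow> sat k s {k..<k + m}"
proof (induction s arbitrary: k m)
  case (Cons c s)
  show ?case
  proof (cases c)
    case And
    then have "sat (Suc k) s {Suc k..<Suc k + (m - 1)}" using Cons by (intro Cons.IH) auto
    then have "sat (Suc k) s {k..<k + m}" by (rule sat_superset) auto
    then show ?thesis using And Cons.prems by auto
  qed (use Cons.prems in auto)
qed auto

text \<open>The word of the first failure of \<open>s\<close> is \<open>s\<close>, then one \<open>\<or>\<close>, then only \<open>\<and>\<close> until \<open>m\<close> elements are
  reached. A larger formula with fewer than \<open>m\<close> symbols \<open>\<and>\<close> is decided no later than at the last of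
  these, and up to there the word is the smallest one that lies above \<open>s\<close>.\<close>

lemma sat_first_failure_of_smaller:
  assumes "(starred s, starred s') \<in> lexord {(a, b). a < b}" "count_list s' And < m"
  shows "sat k s' (first_failure k m s)"
  using assms
proof (induction k m s arbitrary: s' rule: first_failure.induct)
  case (1 k m)
  show ?case
  proof (cases s')
    case (Cons c v)
    then have c: "c = Or" using 1 by (cases c) (auto simp: starred_less_simps)
    have "sat (Suc k) v {Suc k..<Suc k + m}"
      using 1 Cons c by (intro sat_initial_segment) simp
    moreover have "{Suc k..<Suc k + m} = {Suc k..k + m}" by auto
    ultimately show ?thesis using Cons c by simp
  qed (use 1 in \<open>simp add: starred_less_simps\<close>)
next
  case (2 k m s)
  show ?case
  proof (cases s')
    case (Cons c v)
    show ?thesis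
    proof (cases c)
      case And
      then have "sat (Suc k) v (first_failure (Suc k) (m - 1) s)"
        using 2 Cons by (intro "2.IH") (auto simp: starred_less_simps)
      then have "sat (Suc k) v (first_failure k m (And # s))"
        by (rule sat_superset) auto
      then show ?thesis using Cons And by simp
    qed (use Cons in simp)
  qed simp
next
  case (3 k m s)
  show ?case
  proof (cases s')
    case (Cons c v)
    then have "c = Or" using 3 by (cases c) (auto simp: starred_less_simps)
    then show ?thesis using 3 Cons by (auto simp: starred_less_simps)
  qed (use 3 in \<open>simp add: starred_less_simps\<close>)
qed

text \<open>Before its last element, \<open>first_failure k m s\<close> omits only the positions of the \<open>\<or>\<close> in \<open>s\<close> and that
  of the last atom of \<open>s\<close>. As \<open>j\<close> itself is one of the omitted positions, at most \<open>count_list s Or\<close>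
  of them are smaller than \<open>j\<close>.\<close>

lemma gaps_of_first_failure:
  assumes "count_list s And < m" "k \<le> j" "j \<notin> first_failure k m s"
    "card (first_failure k m s \<inter> {k..<j}) < m"
  shows "card ({k..<j} - first_failure k m s) \<le> count_list s Or"
  using assms
proof (induction k m s rule: first_failure.induct)
  case (1 k m)
  \<comment> \<open>Any other omitted position would lie beyond all \<open>m\<close> elements.\<close>
  have "j = k"
  proof (rule ccontr)
    assume "j \<noteq> k"
    then have "{Suc k..k + m} \<inter> {k..<j} = {Suc k..k + m}" using 1 by auto
    then show False using 1 by simp
  qed
  then show ?case by simp
next
  case (2 k m s)
  let ?X = "first_failure (Suc k) (m - 1) s"
  have "j \<noteq> k" using 2 by auto
  then have kj: "Suc k \<le> j" using 2 by simp
  have k: "k \<notin> ?X" using first_failure_ge[of "Suc k" "m - 1" s] by auto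
  have "{k..<j} = insert k {Suc k..<j}" using kj by auto
  then have eq: "insert k ?X \<inter> {k..<j} = insert k (?X \<inter> {Suc k..<j})"
    and eq': "{k..<j} - insert k ?X = {Suc k..<j} - ?X" using k by auto
  have "card (insert k (?X \<inter> {Suc k..<j})) = Suc (card (?X \<inter> {Suc k..<j}))"
    by (rule card_insert_disjoint) auto
  then have "card ({Suc k..<j} - ?X) \<le> count_list s Or"
    using 2 kj eq by (intro "2.IH") auto
  then show ?case by (simp only: first_failure.simps eq' count_list.simps) simp
next
  case (3 k m s)
  let ?X = "first_failure (Suc k) m s"
  show ?case
  proof (cases "j = k")
    case False
    then have kj: "Suc k \<le> j" using 3 by simp
    have k: "k \<notin> ?X" using first_failure_ge[of "Suc k" m s] by auto
    have "{k..<j} = insert k {Suc k..<j}" using kj by auto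
    then have eq: "?X \<inter> {k..<j} = ?X \<inter> {Suc k..<j}"
      and eq': "{k..<j} - ?X = insert k ({Suc k..<j} - ?X)" using k by auto
    have "card (insert k ({Suc k..<j} - ?X)) = Suc (card ({Suc k..<j} - ?X))"
      by (rule card_insert_disjoint) auto
    moreover have "card ({Suc k..<j} - ?X) \<le> count_list s Or"
      using 3 kj eq by (intro "3.IH") auto
    ultimately show ?thesis by (simp add: eq')
  qed simp
qed

definition prefix_word :: "nat set \<Rightarrow> nat \<Rightarrow> connective list" where
  "prefix_word x j = map (\<lambda>i. if i \<in> x then And else Or) [1..<j]"

lemma count_prefix_word:
  "count_list (prefix_word x j) And = card (x \<inter> {1..<j})"
  "count_list (prefix_word x j) Or = card ({1..<j} - x)"
proof -
  have "count_list (prefix_word x j) And = card (x \<inter> {1..<j}) \<and>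
    count_list (prefix_word x j) Or = card ({1..<j} - x)"
  proof (induction j)
    case (Suc j)
    show ?case
    proof (cases "j = 0")
      case False
      have e: "{1..<Suc j} = insert j {1..<j}" using False by auto
      then have "x \<inter> {1..<Suc j} = (if j \<in> x then insert j (x \<inter> {1..<j}) else x \<inter> {1..<j})"
        "{1..<Suc j} - x = (if j \<in> x then {1..<j} - x else insert j ({1..<j} - x))"
        by auto
      then show ?thesis using Suc False by (simp add: prefix_word_def count_list_append)
    qed (simp add: prefix_word_def)
  qed (simp add: prefix_word_def)
  then show "count_list (prefix_word x j) And = card (x \<inter> {1..<j})"
    "count_list (prefix_word x j) Or = card ({1..<j} - x)" by auto
qed

text \<open>Thus \<open>prefix_word x j\<close> separates two sets whose smallest difference is \<open>j\<close>: both follow its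
  connectives, and its last atom is \<open>j\<close>.\<close>

lemma sat_prefix_word:
  assumes "1 \<le> j" "\<And>i. i \<in> {1..<j} \<Longrightarrow> i \<in> e \<longleftrightarrow> i \<in> x"
  shows "sat 1 (prefix_word x j) e \<longleftrightarrow> j \<in> e"
proof -
  have "sat k (map (\<lambda>i. if i \<in> x then And else Or) [k..<j]) e \<longleftrightarrow> j \<in> e" if "1 \<le> k" "k \<le> j" for k
    using that(2,1)
  proof (induction rule: inc_induct)
    case (step k)
    then show ?case using assms(2)[of k] by (simp add: upt_conv_Cons)
  qed simp
  then show ?thesis using assms(1) by (simp add: prefix_word_def)
qed

lemma dual_prefix_word: "dual (Seq (prefix_word x j)) = Seq (prefix_word (- x) j)"
  by (simp add: prefix_word_def)

text \<open>The last property ensures that \<open>prefix_word x j\<close> belongs to \<open>Upsilon r\<close> when an \<open>r\<close>-set that agrees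
  with \<open>x\<close> below \<open>j\<close> contains \<open>j\<close> and \<open>x\<close> does not. If instead \<open>x\<close> contains \<open>j\<close>, membership will follow from
  \<open>card x = r\<close>.\<close>

lemma threshold_exists:
  assumes u: "u \<in> Theta r" and v: "v \<in> Theta r" and less: "u < v" and r: "0 < r"
  obtains x where "\<not> holds u x" "holds v x" "finite x" "card x = r"
    "\<And>j. \<lbrakk>1 \<le> j; j \<notin> x; card (x \<inter> {1..<j}) < r\<rbrakk> \<Longrightarrow> card ({1..<j} - x) < r"
proof (cases u)
  case Alpha
  show ?thesis
  proof (rule that[of "{1..<1 + r}"])
    show "holds v {1..<1 + r}"
    proof (cases v)
      case (Seq s)
      then show ?thesis using v sat_initial_segment[of s r 1]
        by (auto simp: Theta_def Upsilon_def)
    qed (use Alpha less in auto)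
    fix j assume j: "1 \<le> j" "j \<notin> {1..<1 + r}" "card ({1..<1 + r} \<inter> {1..<j}) < r"
    have "{1..<1 + r} \<inter> {1..<j} = {1..<1 + r}" using j by auto
    then show "card ({1..<j} - {1..<1 + r}) < r" using j by simp
  qed (use Alpha in auto)
next
  case (Seq s)
  have s: "count_list s And < r" "count_list s Or < r"
    using u Seq by (auto simp: Theta_def Upsilon_def)
  show ?thesis
  proof (rule that[of "first_failure 1 r s"])
    show "\<not> holds u (first_failure 1 r s)" using Seq not_sat_first_failure by simp
    show "holds v (first_failure 1 r s)"
    proof (cases v)
      case (Seq s')
      have "count_list s' And < r" using v Seq by (auto simp: Theta_def Upsilon_def)
      then show ?thesis
        using Seq \<open>u = Seq s\<close> less sat_first_failure_of_smaller[of s s' r 1] by simp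
    qed (use less in auto)
    fix j assume "1 \<le> j" "j \<notin> first_failure 1 r s" "card (first_failure 1 r s \<inter> {1..<j}) < r"
    then show "card ({1..<j} - first_failure 1 r s) < r"
      using gaps_of_first_failure[of s r 1 j] s by simp
  qed (use s first_failure_finite_card in auto)
next
  case Omega
  then show ?thesis using less by (cases v) auto
qed

lemma card_before_member:
  assumes "f \<in> nsets {1..n::nat} r" "j \<in> f"
  shows "1 \<le> j" "card (f \<inter> {1..<j}) < r"
proof -
  show "1 \<le> j" using assms by (auto simp: nsets_def)
  have "j \<notin> f \<inter> {1..<j}" by simp
  then have "f \<inter> {1..<j} \<subset> f" using assms(2) by blast
  then show "card (f \<inter> {1..<j}) < r"
    using psubset_card_mono[of f "f \<inter> {1..<j}"] assms(1) by (auto simp: nsets_def)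
qed

text \<open>In both inclusions the smallest difference \<open>j\<close> of an \<open>r\<close>-set from \<open>x\<close> (or from its complement)
  yields a formula \<open>prefix_word x j\<close> in \<open>Theta r\<close>: its
  symbols \<open>\<and>\<close> and \<open>\<or>\<close> correspond to elements below \<open>j\<close> of some \<open>r\<close>-set containing \<open>j\<close>, or to gaps
  of \<open>x\<close> controlled by \<open>threshold_exists\<close>, so there are fewer than \<open>r\<close> of each.
  Its truth value on \<open>x\<close> decides whether it lies below \<open>v\<close> or above \<open>u\<close>, hence, by consecutiveness,
  whether it is at most \<open>u\<close> or at least \<open>v\<close>.\<close>

lemma separating_threshold:
  assumes u: "u \<in> Theta r" and v: "v \<in> Theta r" and less: "u < v" and r: "0 < r"
    and consecutive: "\<And>w. w \<in> Theta r \<Longrightarrow> w < v \<Longrightarrow> w \<le> u"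
  obtains x where "below n r x \<subseteq> T n r u" "below n r (- x) \<subseteq> T n r (dual v)"
proof -
  obtain x where x: "\<not> holds u x" "holds v x" "finite x" "card x = r"
    and gaps: "\<And>j. \<lbrakk>1 \<le> j; j \<notin> x; card (x \<inter> {1..<j}) < r\<rbrakk> \<Longrightarrow> card ({1..<j} - x) < r"
    by (rule threshold_exists[OF u v less r]) blast
  have 1: "holds u f" if f: "f \<in> nsets {1..n} r" "precedes f x" for f
  proof -
    obtain j where j: "j \<in> f" "j \<notin> x" "\<And>i. i \<in> {1..<j} \<Longrightarrow> i \<in> f \<longleftrightarrow> i \<in> x"
      using f(2) by (auto simp: precedes_def)
    note j1 = card_before_member[OF f(1) j(1)]
    have "x \<inter> {1..<j} = f \<inter> {1..<j}" using j(3) by blast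
    then have ones: "card (x \<inter> {1..<j}) < r" using j1(2) by simp
    let ?w = "Seq (prefix_word x j)"
    have w: "?w \<in> Theta r"
      using ones gaps[OF j1(1) j(2) ones] by (simp add: Theta_def Upsilon_def count_prefix_word)
    have "\<not> holds ?w x" using sat_prefix_word[of j x x] j1(1) j(2) by simp
    then have "\<not> v \<le> ?w" using holds_mono x(2) by blast
    then have "?w \<le> u" using consecutive[OF w] by simp
    moreover have "holds ?w f" using sat_prefix_word[of j f x] j1(1) j by simp
    ultimately show ?thesis by (rule holds_mono)
  qed
  have 2: "holds (dual v) g" if g: "g \<in> nsets {1..n} r" "precedes g (- x)" for g
  proof -
    obtain j where j: "j \<in> g" "j \<in> x" "\<And>i. i \<in> {1..<j} \<Longrightarrow> i \<in> g \<longleftrightarrow> i \<in> - x"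
      using g(2) by (auto simp: precedes_def)
    note j1 = card_before_member[OF g(1) j(1)]
    have "{1..<j} - x = g \<inter> {1..<j}" using j(3) by blast
    then have zeros: "card ({1..<j} - x) < r" using j1(2) by simp
    have "j \<notin> x \<inter> {1..<j}" by simp
    then have "x \<inter> {1..<j} \<subset> x" using j(2) by blast
    then have ones: "card (x \<inter> {1..<j}) < r" using psubset_card_mono[OF x(3)] x(4) by blast
    let ?w = "Seq (prefix_word x j)"
    have w: "?w \<in> Theta r"
      using ones zeros by (simp add: Theta_def Upsilon_def count_prefix_word)
    have "holds ?w x" using sat_prefix_word[of j x x] j1(1) j(2) by simp
    then have "\<not> ?w \<le> u" using holds_mono x(1) by blast
    then have "v \<le> ?w" using consecutive[OF w] by (metis not_le)
    then have "dual ?w \<le> dual v" by (simp only: dual_le_iff)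
    moreover have "holds (dual ?w) g"
      unfolding dual_prefix_word using sat_prefix_word[of j g "- x"] j1(1) j by simp
    ultimately show ?thesis by (rule holds_mono)
  qed
  show ?thesis
    by (rule that[of x]) (use 1 2 in \<open>auto simp: below_def T_holds\<close>)
qed

section \<open>The value of the maximum\<close>

lemma T_dual_subset_blocker:
  assumes "F \<subseteq> T n r u"
  shows "T n r (dual u) \<subseteq> blocker n r F"
  using assms holds_dual_meets by (fastforce simp: T_holds blocker_def)

lemma card_blocker_upper_bound:
  assumes "2 * r \<le> n" "0 < r" "1 \<le> i" "i \<le> (2 * r) choose r"
    "F \<subseteq> nsets {1..n} r" "M n r (i - 1) < card F"
  shows "card (blocker n r F) \<le> M n r (((2 * r) choose r) - i)"
proof -
  obtain x where x: "below n r x \<subseteq> T n r (\<sigma> r (i - 1))"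
      "below n r (- x) \<subseteq> T n r (dual (\<sigma> r i))"
  proof (rule separating_threshold)
    show "\<sigma> r (i - 1) < \<sigma> r i" using assms by (intro sigma_less) auto
    show "w \<le> \<sigma> r (i - 1)" if "w \<in> Theta r" "w < \<sigma> r i" for w
      using that assms by (intro sigma_predecessor) auto
  qed (use assms sigma_mem in auto)
  have fin: "finite (T n r u)" for u
    by (rule finite_subset[OF _ finite_nsets_interval[of n r]]) (auto simp: T_holds)
  have "cross_intersecting F (blocker n r F)"
    by (auto simp: cross_intersecting_def blocker_def Int_commute)
  then have "card F \<le> card (below n r x) \<or> card (blocker n r F) \<le> card (below n r (- x))"
    using assms by (intro threshold_bound) (auto simp: blocker_def)
  moreover have "card (below n r x) < card F"
    using card_mono[OF fin x(1)] assms(6) by (simp add: M_def)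
  ultimately have "card (blocker n r F) \<le> card (below n r (- x))" by simp
  also have "\<dots> \<le> M n r (((2 * r) choose r) - i)"
    using card_mono[OF fin x(2)] assms(4) by (simp add: M_def sigma_dual)
  finally show ?thesis .
qed

text \<open>Every formula of \<open>Theta r\<close> except \<open>Alpha\<close> is true on \<open>{1..r}\<close>, the lexicographically first \<open>r\<close>-set.\<close>

lemma M_full_set_positive:
  assumes "0 < r" "0 < i" "i \<le> (2 * r) choose r"
  shows "0 < M r r i"
proof -
  have "\<sigma> r 0 < \<sigma> r i" using assms by (intro sigma_less) auto
  then have ne: "\<sigma> r i \<noteq> Alpha" by (cases "\<sigma> r 0") auto
  have "holds (\<sigma> r i) {1..r}"
  proof (cases "\<sigma> r i")
    case (Seq s)
    then have "count_list s And < r"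
      using sigma_mem[OF assms(3)] by (auto simp: Theta_def Upsilon_def)
    then have "sat 1 s {1..<1 + r}" by (rule sat_initial_segment)
    moreover have "{1..<1 + r} = {1..r}" by auto
    ultimately show ?thesis using Seq by simp
  qed (use ne in auto)
  then have "{1..r} \<in> T r r (\<sigma> r i)" by (simp add: T_holds nsets_def)
  moreover have "finite (T r r (\<sigma> r i))"
    by (rule finite_subset[OF _ finite_nsets_interval[of r r]]) (auto simp: T_holds)
  ultimately show ?thesis unfolding M_def by (auto simp: card_gt_0_iff)
qed

theorem theorem2p9:
  fixes n r i t :: nat
  assumes "0 < n" and "0 < r" and "r \<le> n"
    and "n = r \<or> 2 * r \<le> n"
    and "1 \<le> i" and "i \<le> (2 * r) choose r"
    and "M n r (i - 1) < t" and "t \<le> M n r i"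
  shows "max_blocker n r t = M n r (((2 * r) choose r) - i)"
proof -
  let ?m = "M n r (((2 * r) choose r) - i)"
  let ?C = "{card (blocker n r F) | F. F \<subseteq> nsets {1..n} r \<and> card F = t}"
  have fin_nsets: "finite (nsets {1..n} r)" by (rule finite_nsets_interval)
  have fin_blocker: "finite (blocker n r F)" for F
    by (rule finite_subset[OF _ fin_nsets]) (auto simp: blocker_def)
  have upper: "card (blocker n r F) \<le> ?m" if F: "F \<subseteq> nsets {1..n} r" "card F = t" for F
    using assms(4)
  proof
    assume "2 * r \<le> n"
    then show ?thesis using card_blocker_upper_bound[of r n i F] assms F by simp
  next
    \<comment> \<open>The only \<open>r\<close>-set is \<open>{1..r}\<close>, which belongs to every family but the one of \<open>Alpha\<close>. Hence
      \<open>i = 1\<close>, and it suffices that the claimed value is not \<open>0\<close>.\<close>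
    assume nr: "n = r"
    have "2 \<le> 2 * r" using assms(2) by simp
    then have N: "2 \<le> (2 * r) choose r"
      using binomial_maximum'[of r 1] assms(2) by simp
    have single: "nsets {1..r} r = {{1..r}}"
      using card_subset_eq[of "{1..r}"] by (auto simp: nsets_def)
    have "M r r i \<le> card (nsets {1..r} r)"
      unfolding M_def by (rule card_mono[OF finite_nsets_interval]) (auto simp: T_holds)
    then have "M r r (i - 1) = 0" using assms(7,8) single nr by simp
    then have "i = 1"
      using M_full_set_positive[of r "i - 1"] assms(2,5,6) by force
    then have "1 \<le> ?m"
      using M_full_set_positive[of r "((2 * r) choose r) - i"] assms(2) N nr by simp
    moreover have "card (blocker n r F) \<le> card (nsets {1..r} r)"
      unfolding nr by (rule card_mono[OF finite_nsets_interval]) (auto simp: blocker_def)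
    ultimately show ?thesis using single by simp
  qed
  obtain F where F: "F \<subseteq> T n r (\<sigma> r i)" "card F = t"
    using assms(8) obtain_subset_with_card_n unfolding M_def by metis
  have FN: "F \<subseteq> nsets {1..n} r" using F(1) by (auto simp: T_holds)
  have "?m \<le> card (blocker n r F)"
    using card_mono[OF fin_blocker T_dual_subset_blocker[OF F(1)]] assms(6)
    by (simp add: M_def sigma_dual)
  then have "?m = card (blocker n r F)" using upper[OF FN F(2)] by simp
  then have "?m \<in> ?C" using FN F(2) by blast
  moreover have "finite ?C"
    by (rule finite_subset[of _ "{..?m}"]) (use upper in auto)
  ultimately show ?thesis
    unfolding max_blocker_def by (intro Max_eqI) (use upper in auto)
qed

end
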